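(* (Poincaré inequality.) Let $C^0,\dots,C^d$ be the graph cochain spaces of a finite clique complex, with data-driven coboundaries $\mathsf{d}_k=\mathbf{B}_{k+1}\delta_k\mathbf{B}_k^{-1}$, codifferentials $\mathsf{d}_k^*=\mathbf{D}_k^{-1}\delta_k^*\mathbf{D}_{k+1}$, and Hodge Laplacians $\Delta_k=\mathsf{d}_{k-1}\mathsf{d}_{k-1}^*+\mathsf{d}_k^*\mathsf{d}_k$, where $\mathbf{B}_k,\mathbf{D}_k$ are diagonal with positive diagonal entries. Let $\|\cdot\|_k$ be the norm induced by the inner product $(\mathbf{x},\mathbf{y})_k:=\mathbf{x}^{T}\mathbf{D}_k\mathbf{B}_k^{-1}\mathbf{y}$ on $C^k$. Then for each $0\le k\le d$ there exists a constant $c_{P,k}$ such that $$\|\mathbf{z}_k\|_k\le c_{P,k}\,\|\mathsf{d}_k\mathbf{z}_k\|_{k+1}\qquad\text{for all }\mathbf{z}_k\in\operatorname{im}(\mathsf{d}_k^* ),$$ and a constant $c_{P,k}^*$ such that $$\|\mathbf{z}_k\|_k\le c_{P,k}^*\,\|\mathsf{d}_{k-1}^*\mathbf{z}_k\|_{k-1}\qquad\text{for all }\mathbf{z}_k\in\operatorname{im}(\mathsf{d}_{k-1}).$$ Consequently, for all $\mathbf{u}_k\in C^k$, $$\inf_{\mathbf{h}_k\in\ker(\Delta_k)}\|\mathbf{u}_k-\mathbf{h}_k\|_k\le C\left(\|\mathsf{d}_k\mathbf{u}_k\|_{k+1}+\|\mathsf{d}_{k-1}^*\mathbf{u}_k\|_{k-1}\right),$$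 where the constant $C>0$ depends only on $c_{P,k}$ and $c_{P,k}^*$.
   Context: Fix $d\ge 1$, a finite node set, and a finite family of cliques (nonempty sets of at most $d+1$ nodes) that is closed under taking nonempty subsets (a simplicial complex). $C^k$ is the finite-dimensional real vector space of $k$-cochains: alternating real-valued functions $\phi$ on ordered $(k+1)$-cliques, $\phi_{i_{\pi(0)}\cdots i_{\pi(k)}}=\operatorname{sgn}(\pi)\,\phi_{i_0\cdots i_k}$. Fixing one orientation for each $(k+1)$-clique identifies $C^k$ with $\mathbb{R}^{N_k}$, where $N_k$ is the number of $(k+1)$-cliques; diagonal matrices and transposes are taken in these coordinates. The coboundary $\delta_k:C^k\to C^{k+1}$ is $$(\delta_k\phi)_{i_0\cdots i_{k+1}}=\sum_{j=0}^{k+1}(-1)^j\phi_{i_0\cdots\widehat{i_j}\cdots i_{k+1}},$$ which satisfies $\delta_{k+1}\circ\delta_k=0$, and $\delta_k^*:C^{k+1}\to C^k$ is its transpose. For $0\le k\le d$, $\mathbf{B}_k$ and $\mathbf{D}_k$ are arbitrary diagonal matrices with positive diagonal entries acting on $C^k$. Convention: $C^{-1}=C^{d+1}=0$, so $\mathsf{d}_{-1}$, $\mathsf{d}_{-1}^*$, $\mathsf{d}_d$, $\mathsf{d}_d^*$ are zero maps. The constants may depend on $k$, the complex, and the matrices $\mathbf{B}_j,\mathbf{D}_j$, but not on the cochains. *)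

theory Defs
  imports
    "HOL-Combinatorics.Permutations"
    "Jordan_Normal_Form.Gauss_Jordan_Elimination"
    "Jordan_Normal_Form.Matrix_Kernel"
begin

section \<open>Clique complexes and cochains\<close>

definition clique_complex :: "nat \<Rightarrow> 'a set \<Rightarrow> 'a set set \<Rightarrow> bool" where
  "clique_complex d V K \<longleftrightarrow> finite V \<and>
     (\<forall>s\<in>K. s \<subseteq> V \<and> s \<noteq> {} \<and> card s \<le> d + 1) \<and>
     (\<forall>s\<in>K. \<forall>t. t \<noteq> {} \<and> t \<subseteq> s \<longrightarrow> t \<in> K)"

text \<open>
  Degrees are integers, so that the conventions $C^{-1} = C^{d+1} = 0$ need no special treatment:
  a clique is nonempty and has at most \<open>d + 1\<close> nodes, hence there are no ordered cliques of degree
  \<open>-1\<close> or \<open>d + 1\<close>, and the corresponding matrices below have no rows or no columns.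
\<close>

definition cliques :: "'a set set \<Rightarrow> int \<Rightarrow> 'a set set" where
  "cliques K k = {s \<in> K. int (card s) = k + 1}"

definition ordered_cliques :: "'a set set \<Rightarrow> int \<Rightarrow> 'a list set" where
  "ordered_cliques K k = {xs. distinct xs \<and> set xs \<in> K \<and> int (length xs) = k + 1}"

text \<open>A cochain is extended by \<open>0\<close> outside the ordered cliques of its degree.\<close>

definition cochains :: "'a set set \<Rightarrow> int \<Rightarrow> ('a list \<Rightarrow> real) set" where
  "cochains K k = {\<phi>.
     (\<forall>xs. xs \<notin> ordered_cliques K k \<longrightarrow> \<phi> xs = 0) \<and>
     (\<forall>xs\<in>ordered_cliques K k. \<forall>\<pi>. \<pi> permutes {..<length xs} \<longrightarrow>
        \<phi> (permute_list \<pi> xs) = of_int (sign \<pi>) * \<phi> xs)}"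

definition coboundary :: "'a set set \<Rightarrow> int \<Rightarrow> ('a list \<Rightarrow> real) \<Rightarrow> 'a list \<Rightarrow> real" where
  "coboundary K k \<phi> xs =
     (if xs \<in> ordered_cliques K (k + 1)
      then \<Sum>j<length xs. (-1) ^ j * \<phi> (take j xs @ drop (Suc j) xs) else 0)"


section \<open>Coordinates\<close>

text \<open>
  An orientation in degree \<open>k\<close> lists exactly one ordering of each clique with \<open>k + 1\<close> nodes;
  the position in the list serves as the coordinate index in $\{0,\dots,N_k-1\}$.
\<close>

definition is_orientation :: "'a set set \<Rightarrow> int \<Rightarrow> 'a list list \<Rightarrow> bool" where
  "is_orientation K k L \<longleftrightarrow>
     set L \<subseteq> ordered_cliques K k \<and> distinct (map set L) \<and> set (map set L) = cliques K k"

abbreviation dimC :: "(int \<Rightarrow> 'a list list) \<Rightarrow> int \<Rightarrow> nat" where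
  "dimC ori k \<equiv> length (ori k)"

definition coords :: "(int \<Rightarrow> 'a list list) \<Rightarrow> int \<Rightarrow> ('a list \<Rightarrow> real) \<Rightarrow> real vec" where
  "coords ori k \<phi> = vec (dimC ori k) (\<lambda>i. \<phi> (ori k ! i))"

text \<open>
  Inverse of \<open>coords\<close> (see \<open>coords_bij\<close> below); it is the identification of $\mathbb{R}^{N_k}$
  with $C^k$.
\<close>

definition cochain_of ::
    "'a set set \<Rightarrow> (int \<Rightarrow> 'a list list) \<Rightarrow> int \<Rightarrow> real vec \<Rightarrow> 'a list \<Rightarrow> real" where
  "cochain_of K ori k = the_inv_into (cochains K k) (coords ori k)"

text \<open>The matrix of \<open>coboundary\<close> in these coordinates: column \<open>j\<close> is the image of the \<open>j\<close>-th basis cochain.\<close>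

definition cob_mat :: "'a set set \<Rightarrow> (int \<Rightarrow> 'a list list) \<Rightarrow> int \<Rightarrow> real mat" where
  "cob_mat K ori k = mat (dimC ori (k + 1)) (dimC ori k)
     (\<lambda>(i, j). coboundary K k (cochain_of K ori k (unit_vec (dimC ori k) j)) (ori (k + 1) ! i))"


section \<open>Data-driven operators\<close>

text \<open>
  In the theorem this is required in every degree: outside \<open>0..d\<close> the size is \<open>0\<close>, so nothing is
  required there beyond being the $0 \times 0$ matrix. \<open>minv\<close> is a genuine inverse on such matrices
  (lemma \<open>minv\<close> below).
\<close>

definition pos_diag :: "nat \<Rightarrow> real mat \<Rightarrow> bool" where
  "pos_diag n A \<longleftrightarrow> A \<in> carrier_mat n n \<and> diagonal_mat A \<and> (\<forall>i<n. 0 < A $$ (i, i))"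

abbreviation minv :: "real mat \<Rightarrow> real mat" where
  "minv A \<equiv> the (mat_inverse A)"

definition dd :: "'a set set \<Rightarrow> (int \<Rightarrow> 'a list list) \<Rightarrow> (int \<Rightarrow> real mat) \<Rightarrow> int \<Rightarrow> real mat" where
  "dd K ori B k = B (k + 1) * cob_mat K ori k * minv (B k)"

definition dd_star :: "'a set set \<Rightarrow> (int \<Rightarrow> 'a list list) \<Rightarrow> (int \<Rightarrow> real mat) \<Rightarrow> int \<Rightarrow> real mat" where
  "dd_star K ori D k = minv (D k) * transpose_mat (cob_mat K ori k) * D (k + 1)"

definition laplacian ::
    "'a set set \<Rightarrow> (int \<Rightarrow> 'a list list) \<Rightarrow> (int \<Rightarrow> real mat) \<Rightarrow> (int \<Rightarrow> real mat) \<Rightarrow> int \<Rightarrow> real mat" where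
  "laplacian K ori B D k =
     dd K ori B (k - 1) * dd_star K ori D (k - 1) + dd_star K ori D k * dd K ori B k"

definition mat_im :: "real mat \<Rightarrow> real vec set" where
  "mat_im A = (\<lambda>v. A *\<^sub>v v) ` carrier_vec (dim_col A)"

definition ip :: "(int \<Rightarrow> real mat) \<Rightarrow> (int \<Rightarrow> real mat) \<Rightarrow> int \<Rightarrow> real vec \<Rightarrow> real vec \<Rightarrow> real" where
  "ip B D k x y = x \<bullet> ((D k * minv (B k)) *\<^sub>v y)"

definition nrm :: "(int \<Rightarrow> real mat) \<Rightarrow> (int \<Rightarrow> real mat) \<Rightarrow> int \<Rightarrow> real vec \<Rightarrow> real" where
  "nrm B D k x = sqrt (ip B D k x x)"


section \<open>The two Poincare inequalities with given constants\<close>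

definition poincare ::
    "'a set set \<Rightarrow> (int \<Rightarrow> 'a list list) \<Rightarrow> (int \<Rightarrow> real mat) \<Rightarrow> (int \<Rightarrow> real mat) \<Rightarrow> int \<Rightarrow> real \<Rightarrow> bool" where
  "poincare K ori B D k c \<longleftrightarrow>
     (\<forall>z \<in> mat_im (dd_star K ori D k). nrm B D k z \<le> c * nrm B D (k + 1) (dd K ori B k *\<^sub>v z))"

definition poincare_star ::
    "'a set set \<Rightarrow> (int \<Rightarrow> 'a list list) \<Rightarrow> (int \<Rightarrow> real mat) \<Rightarrow> (int \<Rightarrow> real mat) \<Rightarrow> int \<Rightarrow> real \<Rightarrow> bool" where
  "poincare_star K ori B D k c \<longleftrightarrow>
     (\<forall>z \<in> mat_im (dd K ori B (k - 1)).
        nrm B D k z \<le> c * nrm B D (k - 1) (dd_star K ori D (k - 1) *\<^sub>v z))"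


section \<open>Soundness of the coordinate description\<close>

lemma permute_list_inj:
  assumes "distinct l" "p permutes {..<length l}" "q permutes {..<length l}"
    "permute_list p l = permute_list q l"
  shows "p = q"
proof
  fix i
  show "p i = q i"
  proof (cases "i < length l")
    case True
    have "l ! p i = l ! q i"
      using permute_list_nth[OF assms(2) True] permute_list_nth[OF assms(3) True] assms(4) by simp
    moreover have "p i < length l" "q i < length l"
      using permutes_in_image[OF assms(2), of i] permutes_in_image[OF assms(3), of i] True by auto
    ultimately show ?thesis using assms(1) by (simp add: nth_eq_iff_index_eq)
  next
    case False
    then show ?thesis using assms(2,3) by (simp add: permutes_def)
  qed
qed

lemma ordered_clique_index:
  assumes "is_orientation K k L" "xs \<in> ordered_cliques K k"
  obtains i p where "i < length L" "p permutes {..<length (L ! i)}" "permute_list p (L ! i) = xs"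
    "set (L ! i) = set xs"
proof -
  have "set xs \<in> cliques K k"
    using assms(2) by (auto simp: ordered_cliques_def cliques_def distinct_card)
  then have "set xs \<in> set (map set L)" using assms(1) by (simp add: is_orientation_def)
  then obtain i where i: "i < length L" "set (L ! i) = set xs"
    by (auto simp: in_set_conv_nth)
  then have "L ! i \<in> ordered_cliques K k" using assms(1) by (auto simp: is_orientation_def)
  then have "mset (L ! i) = mset xs"
    using i assms(2) set_eq_iff_mset_eq_distinct by (auto simp: ordered_cliques_def)
  then obtain p where "p permutes {..<length (L ! i)}" "permute_list p (L ! i) = xs"
    using mset_eq_permutation by metis
  then show ?thesis using i that by blast
qed

lemma orientation_unique:
  assumes "is_orientation K k L" "i < length L" "j < length L" "set (L ! i) = set (L ! j)"
  shows "i = j"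
proof -
  have "map set L ! i = map set L ! j" using assms by simp
  then show ?thesis
    using assms by (metis is_orientation_def length_map nth_eq_iff_index_eq)
qed

theorem coords_bij:
  assumes ori: "is_orientation K k (ori k)"
  shows "bij_betw (coords ori k) (cochains K k) (carrier_vec (dimC ori k))"
proof -
  let ?L = "ori k"
  have L: "?L ! i \<in> ordered_cliques K k" if "i < length ?L" for i
    using that ori by (auto simp: is_orientation_def)
  have inj: "inj_on (coords ori k) (cochains K k)"
  proof (rule inj_onI)
    fix \<phi> \<psi> assume a: "\<phi> \<in> cochains K k" "\<psi> \<in> cochains K k" "coords ori k \<phi> = coords ori k \<psi>"
    show "\<phi> = \<psi>"
    proof
      fix xs
      show "\<phi> xs = \<psi> xs"
      proof (cases "xs \<in> ordered_cliques K k")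
        case True
        from ordered_clique_index[OF ori True] obtain i p where
          ip: "i < length ?L" "p permutes {..<length (?L ! i)}" "permute_list p (?L ! i) = xs" .
        have "coords ori k \<phi> $ i = coords ori k \<psi> $ i" using a(3) by simp
        then have "\<phi> (?L ! i) = \<psi> (?L ! i)" using ip(1) by (simp add: coords_def)
        moreover have "\<phi> xs = of_int (sign p) * \<phi> (?L ! i)" "\<psi> xs = of_int (sign p) * \<psi> (?L ! i)"
          using a(1,2) L[OF ip(1)] ip(2) unfolding cochains_def ip(3)[symmetric] by auto
        ultimately show ?thesis by simp
      next
        case False
        then show ?thesis using a by (simp add: cochains_def)
      qed
    qed
  qed
  have surj: "\<exists>\<phi>\<in>cochains K k. coords ori k \<phi> = v" if v: "v \<in> carrier_vec (dimC ori k)" for v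
  proof -
    define P where "P xs i p \<longleftrightarrow> i < length ?L \<and> p permutes {..<length (?L ! i)} \<and>
      permute_list p (?L ! i) = xs" for xs i p
    have P_unique: "i = j \<and> p = q" if "P xs i p" "P xs j q" for xs i j p q
    proof -
      have "set (?L ! i) = set xs" "set (?L ! j) = set xs"
        using that unfolding P_def by (metis set_permute_list)+
      then have "i = j" using orientation_unique[OF ori] that by (auto simp: P_def)
      moreover have "distinct (?L ! i)" using L that by (auto simp: P_def ordered_cliques_def)
      ultimately show ?thesis using permute_list_inj that by (metis P_def)
    qed
    define \<phi> where "\<phi> xs = (if xs \<in> ordered_cliques K k
      then (THE r. \<exists>i p. P xs i p \<and> r = of_int (sign p) * v $ i) else 0)" for xs
    have \<phi>: "\<phi> xs = of_int (sign p) * v $ i" if "P xs i p" "xs \<in> ordered_cliques K k" for xs i p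
      unfolding \<phi>_def using that(2) by (simp, intro the_equality) (use that(1) P_unique in blast)+
    have "\<phi> \<in> cochains K k"
      unfolding cochains_def
    proof (intro CollectI conjI ballI allI impI)
      show "\<phi> xs = 0" if "xs \<notin> ordered_cliques K k" for xs using that by (simp add: \<phi>_def)
    next
      fix xs q assume xs: "xs \<in> ordered_cliques K k" and q: "q permutes {..<length xs}"
      from ordered_clique_index[OF ori xs] obtain i p where ip: "P xs i p"
        unfolding P_def by metis
      have len: "length xs = length (?L ! i)" using ip by (auto simp: P_def)
      have P': "P (permute_list q xs) i (p \<circ> q)"
        using ip q len by (auto simp: P_def permutes_compose permute_list_compose)
      have "permute_list q xs \<in> ordered_cliques K k"
        using xs q by (simp add: ordered_cliques_def)
      then have "\<phi> (permute_list q xs) = of_int (sign (p \<circ> q)) * v $ i" using \<phi> P' by blast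
      also have "sign (p \<circ> q) = sign p * sign q"
        using ip q len by (intro sign_compose) (auto simp: P_def intro: permutation_permutes[THEN iffD2])
      finally show "\<phi> (permute_list q xs) = of_int (sign q) * \<phi> xs"
        using \<phi>[OF ip xs] by simp
    qed
    moreover have "coords ori k \<phi> = v"
    proof (rule eq_vecI)
      show "coords ori k \<phi> $ i = v $ i" if "i < dim_vec v" for i
      proof -
        have i: "i < length ?L" using that v by simp
        then have "P (?L ! i) i id" by (simp add: P_def permutes_id)
        from \<phi>[OF this L[OF i]] show ?thesis using i by (simp add: coords_def)
      qed
    qed (use v in \<open>simp add: coords_def\<close>)
    ultimately show ?thesis by blast
  qed
  have "coords ori k ` cochains K k \<subseteq> carrier_vec (dimC ori k)"
    by (auto simp: coords_def)
  with inj surj show ?thesis unfolding bij_betw_def by blast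
qed

lemma cochain_of:
  assumes "is_orientation K k (ori k)" "v \<in> carrier_vec (dimC ori k)"
  shows "cochain_of K ori k v \<in> cochains K k" "coords ori k (cochain_of K ori k v) = v"
  using coords_bij[of K k ori] assms unfolding cochain_of_def bij_betw_def
  by (metis subset_refl the_inv_into_into, metis f_the_inv_into_f)

theorem coords_coboundary:
  assumes ori: "is_orientation K k (ori k)" and \<phi>: "\<phi> \<in> cochains K k"
  shows "coords ori (k + 1) (coboundary K k \<phi>) = cob_mat K ori k *\<^sub>v coords ori k \<phi>"
proof -
  let ?n = "dimC ori k"
  define e where "e j = cochain_of K ori k (unit_vec ?n j)" for j
  have e: "e j \<in> cochains K k" "coords ori k (e j) = unit_vec ?n j" for j
    using cochain_of[where ori = ori and k = k, OF ori] by (auto simp: e_def)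
  define \<psi> where "\<psi> xs = (\<Sum>j<?n. e j xs * \<phi> (ori k ! j))" for xs
  have e_val: "e j (ori k ! i) = (if i = j then 1 else 0)" if "i < ?n" "j < ?n" for i j
    using arg_cong[OF e(2), of "\<lambda>v. v $ i" j] that by (simp add: coords_def)
  have "\<psi> \<in> cochains K k"
    using e(1) unfolding cochains_def \<psi>_def
    by (auto simp: sum_distrib_left mult.assoc intro!: sum.cong sum.neutral)
  moreover have "coords ori k \<psi> = coords ori k \<phi>"
    by (rule eq_vecI) (auto simp: coords_def \<psi>_def e_val if_distrib[of "\<lambda>x. x * _"] sum.delta cong: if_cong)
  ultimately have "\<psi> = \<phi>"
    using coords_bij[where ori = ori and k = k, OF ori] \<phi> by (meson bij_betw_def inj_onD)
  then have exp: "\<phi> xs = (\<Sum>j<?n. e j xs * \<phi> (ori k ! j))" for xs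
    unfolding \<psi>_def by metis
  have "coboundary K k \<phi> xs = (\<Sum>j<?n. coboundary K k (e j) xs * \<phi> (ori k ! j))" for xs
  proof (cases "xs \<in> ordered_cliques K (k + 1)")
    case True
    have "coboundary K k \<phi> xs =
        (\<Sum>l<length xs. \<Sum>j<?n. (-1) ^ l * (e j (take l xs @ drop (Suc l) xs) * \<phi> (ori k ! j)))"
      using True unfolding coboundary_def
      by (simp add: sum_distrib_left[symmetric] exp[of "take _ xs @ drop _ xs", symmetric])
    then show ?thesis
      using True by (subst (asm) sum.swap) (simp add: coboundary_def sum_distrib_right mult.assoc)
  qed (simp add: coboundary_def)
  then show ?thesis
    by (intro eq_vecI)
      (simp_all add: coords_def cob_mat_def scalar_prod_def e_def lessThan_atLeast0)
qed

lemma minv: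
  assumes A: "pos_diag n A"
  shows "minv A \<in> carrier_mat n n" "A * minv A = 1\<^sub>m n" "minv A * A = 1\<^sub>m n"
proof -
  have car: "A \<in> carrier_mat n n" using A by (simp add: pos_diag_def)
  define C where "C = mat n n (\<lambda>(i, j). if i = j then inverse (A $$ (i, i)) else 0)"
  have off: "A $$ (i, j) = 0" if "i < n" "j < n" "i \<noteq> j" for i j
    using A that by (auto simp: pos_diag_def diagonal_mat_def)
  have pos: "A $$ (i, i) \<noteq> 0" if "i < n" for i using A that by (auto simp: pos_diag_def)
  have C: "C \<in> carrier_mat n n" by (simp add: C_def)
  have "A * C = 1\<^sub>m n"
  proof (rule eq_matI)
    fix i j assume "i < dim_row (1\<^sub>m n :: real mat)" "j < dim_col (1\<^sub>m n :: real mat)"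
    then have ij: "i < n" "j < n" by auto
    have "(A * C) $$ (i, j) = (\<Sum>l = 0..<n. A $$ (i, l) * C $$ (l, j))"
      using ij car C by (simp add: scalar_prod_def)
    also have "\<dots> = (\<Sum>l = 0..<n. if l = j then A $$ (i, j) * inverse (A $$ (j, j)) else 0)"
      using ij by (intro sum.cong) (auto simp: C_def)
    also have "\<dots> = 1\<^sub>m n $$ (i, j)" using ij off pos by (auto simp: sum.delta)
    finally show "(A * C) $$ (i, j) = 1\<^sub>m n $$ (i, j)" .
  qed (use car C in auto)
  moreover from this have "C * A = 1\<^sub>m n" using mat_mult_left_right_inverse[OF car C] by simp
  ultimately have "A \<in> Units (ring_mat TYPE(real) n ())"
    using car C by (auto simp: Units_def ring_mat_def)
  then obtain B where "mat_inverse A = Some B"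
    using mat_inverse(1)[OF car, of "()"] by (cases "mat_inverse A") auto
  with mat_inverse(2)[OF car this]
  show "minv A \<in> carrier_mat n n" "A * minv A = 1\<^sub>m n" "minv A * A = 1\<^sub>m n" by auto
qed

end

theory Submission
  imports Defs "Jordan_Normal_Form.Determinant" "HOL-Analysis.L2_Norm"
begin

text \<open>
  With respect to the weighted inner products, whose weights are the entries of
  $\mathbf{D}_k\mathbf{B}_k^{-1}$, the codifferential $\mathsf{d}_k^*$ is the adjoint of
  $\mathsf{d}_k$: in the product $\mathbf{D}_k\mathbf{B}_k^{-1}\mathbf{D}_k^{-1}$ diagonal matrices
  commute and the factors \<open>D\<close> cancel (\<open>dd_star_eq_wadj\<close>). The rest is finite-dimensional Hodge
  theory for an adjoint pair.

  For the Poincare inequality, let \<open>G\<close> be a generalized inverse of \<open>A\<close>, that is $AGA = A$. If \<open>z\<close>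
  lies in the image of the adjoint of \<open>A\<close>, then $z - GAz$ lies in the kernel of \<open>A\<close> and is therefore
  orthogonal to \<open>z\<close>. Hence $(z,z) = (z, GAz)$, so the norm of \<open>z\<close> is at most that of $GAz$, and the
  matrix \<open>G\<close> is bounded (\<open>poincare_wadj\<close>). The two inequalities of the theorem are the cases
  $A = \mathsf{d}_k$ and $A = \mathsf{d}_{k-1}^*$.

  For the distance to the harmonic cochains, self-adjointness of the Laplacian $\Delta$ makes
  $\Delta\Delta y = \Delta u$ solvable (\<open>self_adjoint_square_solvable\<close>); then $h = u - \Delta y$ is
  harmonic, and $u - h = p + q$ with $p = \mathsf{d}\mathsf{d}^*y$ and $q = \mathsf{d}^*\mathsf{d}y$
  (\<open>hodge_decomposition\<close>). Because $\mathsf{d}\mathsf{d} = 0$, also $\mathsf{d}^*\mathsf{d}^* = 0$, so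
  $\mathsf{d}u = \mathsf{d}q$ and $\mathsf{d}^*u = \mathsf{d}^*p$. Applying the given inequalities to \<open>p\<close>
  and \<open>q\<close> bounds the distance in terms of the two Poincare constants alone
  (\<open>harmonic_distance_bound\<close>).

  On the combinatorial side, $\mathsf{d}\mathsf{d} = 0$ comes from the classical cancellation of
  twice-deleted faces. The matrix of the coboundary only records its values on one chosen ordering of
  each clique, so carrying the cancellation over to matrices also needs that the coboundary of an
  alternating function is alternating (\<open>coboundary_in_cochains\<close>).
\<close>

section \<open>The coboundary squares to zero\<close>

abbreviation face :: "nat \<Rightarrow> 'a list \<Rightarrow> 'a list" where
  "face j xs \<equiv> take j xs @ drop (Suc j) xs"

lemma face_nth:
  assumes "j < length xs" "i < length xs - 1"
  shows "face j xs ! i = xs ! insert_index j i"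
  using assms by (auto simp: nth_append insert_index_def min_def)

text \<open>
  Deleting entry \<open>j\<close> after permuting amounts to deleting entry \<open>p j\<close> before, followed by the
  permutation that \<open>p\<close> induces on the remaining positions. The signs are those of the Laplace
  expansion of a determinant: crossing out row \<open>j\<close> and column \<open>p j\<close> of the permutation matrix
  changes its determinant by $(-1)^{j + p(j)}$.
\<close>

lemma face_permute_list:
  assumes p: "p permutes {..<length xs}" and j: "j < length xs"
  shows "face j (permute_list p xs) = permute_list (permutation_delete p j) (face (p j) xs)"
    and "permutation_delete p j permutes {..<length (face (p j) xs)}"
    and "sign p = (-1) ^ (j + p j) * sign (permutation_delete p j)"
proof -
  obtain n where n: "length xs = Suc n" using j by (cases "length xs") auto
  have p': "p permutes {0..<Suc n}" using p n by (simp add: atLeast0LessThan)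
  have pj: "p j < Suc n" using permutes_in_image[OF p, of j] j n by auto
  let ?q = "permutation_delete p j"
  have q: "?q permutes {0..<n}" using permutation_delete_permutes[OF p'] j n by simp
  have len: "length (face (p j) xs) = n" using pj n by simp
  show q': "?q permutes {..<length (face (p j) xs)}"
    using q unfolding len by (simp add: atLeast0LessThan)
  show "face j (permute_list p xs) = permute_list ?q (face (p j) xs)"
  proof (rule nth_equalityI)
    show "length (face j (permute_list p xs)) = length (permute_list ?q (face (p j) xs))"
      using j n pj by simp
  next
    fix i assume "i < length (face j (permute_list p xs))"
    then have i: "i < n" using j n by simp
    have ii: "insert_index j i < Suc n" using i by (simp add: insert_index_def)
    have qi: "?q i < n" using permutes_in_image[OF q, of i] i by auto
    have ne: "p (insert_index j i) \<noteq> p j"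
      using permutes_inj[OF p] by (metis injD insert_index_exclude)
    have "face j (permute_list p xs) ! i = permute_list p xs ! insert_index j i"
      using face_nth[of j "permute_list p xs" i] j n i by simp
    also have "\<dots> = xs ! p (insert_index j i)"
      using permute_list_nth[OF p] ii n by simp
    also have "p (insert_index j i) = insert_index (p j) (?q i)"
      using insert_delete_index[OF ne]
      by (simp add: permutation_delete_def delete_ran_def delete_dom_def)
    also have "xs ! insert_index (p j) (?q i) = face (p j) xs ! ?q i"
      using face_nth[of "p j" xs "?q i"] pj n qi by simp
    also have "\<dots> = permute_list ?q (face (p j) xs) ! i"
      using permute_list_nth[OF q'] i len by simp
    finally show "face j (permute_list p xs) ! i = permute_list ?q (face (p j) xs) ! i" .
  qed
  have "sign (permutation_insert j (p j) ?q) = (-1::int) ^ (j + p j) * sign ?q"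
    using signof_permutation_insert[OF q, of j "p j", where ?'a = int] j n pj by simp
  then show "sign p = (-1) ^ (j + p j) * sign ?q"
    using permutation_insert_delete[OF p'] j n by simp
qed

lemma cochain_permute_list:
  assumes "\<phi> \<in> cochains K k" "p permutes {..<length xs}"
  shows "\<phi> (permute_list p xs) = of_int (sign p) * \<phi> xs"
proof (cases "xs \<in> ordered_cliques K k")
  case False
  then have "permute_list p xs \<notin> ordered_cliques K k"
    using assms(2) by (simp add: ordered_cliques_def)
  then show ?thesis using False assms(1) by (simp add: cochains_def)
qed (use assms in \<open>auto simp: cochains_def\<close>)

text \<open>
  By \<open>face_permute_list\<close> the sign $(-1)^j$ of the \<open>j\<close>-th face of the permuted list, multiplied by the
  sign of the permutation induced on that face, is $(-1)^{p(j)}$ times the sign of \<open>p\<close>; reindexing the sum along \<open>p\<close> then yields the coboundary of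
  the original list.
\<close>

lemma coboundary_in_cochains:
  assumes \<phi>: "\<phi> \<in> cochains K k"
  shows "coboundary K k \<phi> \<in> cochains K (k + 1)"
  unfolding cochains_def
proof (intro CollectI conjI ballI allI impI)
  fix xs p assume xs: "xs \<in> ordered_cliques K (k + 1)" and p: "p permutes {..<length xs}"
  let ?n = "length xs"
  have pxs: "permute_list p xs \<in> ordered_cliques K (k + 1)"
    using xs p by (simp add: ordered_cliques_def)
  have "coboundary K k \<phi> (permute_list p xs) = (\<Sum>j<?n. (-1) ^ j * \<phi> (face j (permute_list p xs)))"
    using pxs by (simp add: coboundary_def)
  also have "\<dots> = (\<Sum>j<?n. of_int (sign p) * ((-1) ^ p j * \<phi> (face (p j) xs)))"
  proof (rule sum.cong[OF refl])
    fix j assume "j \<in> {..<?n}"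
    then have j: "j < ?n" by simp
    note f = face_permute_list[OF p j]
    have "\<phi> (face j (permute_list p xs)) =
        of_int (sign (permutation_delete p j)) * \<phi> (face (p j) xs)"
      using cochain_permute_list[OF \<phi> f(2)] f(1) by simp
    moreover have "of_int (sign p) * (-1) ^ p j
        = (-1::real) ^ j * of_int (sign (permutation_delete p j))"
      unfolding f(3) by (simp add: power_add)
    ultimately show "(-1) ^ j * \<phi> (face j (permute_list p xs))
        = of_int (sign p) * ((-1) ^ p j * \<phi> (face (p j) xs))"
      by (metis mult.assoc)
  qed
  also have "\<dots> = of_int (sign p) * (\<Sum>j<?n. (-1) ^ p j * \<phi> (face (p j) xs))"
    by (simp add: sum_distrib_left)
  also have "(\<Sum>j<?n. (-1) ^ p j * \<phi> (face (p j) xs)) = (\<Sum>j<?n. (-1) ^ j * \<phi> (face j xs))"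
    using sum.permute[OF p, of "\<lambda>j. (-1) ^ j * \<phi> (face j xs)"] by (simp add: o_def)
  also have "\<dots> = coboundary K k \<phi> xs" using xs by (simp add: coboundary_def)
  finally show "coboundary K k \<phi> (permute_list p xs) = of_int (sign p) * coboundary K k \<phi> xs" .
qed (simp add: coboundary_def)

text \<open>
  The map $(j, l) \mapsto (l + 1, j)$ is a sign-reversing bijection from the pairs with $j \le l$ to
  those with $l < j$.
\<close>

lemma alternating_double_sum_eq_0:
  fixes G :: "nat \<Rightarrow> nat \<Rightarrow> real"
  assumes G: "\<And>j l. j \<le> l \<Longrightarrow> l < n \<Longrightarrow> G j l = G (Suc l) j"
  shows "(\<Sum>j<Suc n. \<Sum>l<n. (-1) ^ j * (-1) ^ l * G j l) = 0"
proof -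
  let ?f = "\<lambda>(j, l). (-1) ^ j * (-1) ^ l * G j l"
  let ?S = "{..<Suc n} \<times> {..<n}"
  let ?A = "{(j, l). j \<le> l \<and> l < n}" and ?B = "{(j, l). l < j \<and> j < Suc n}"
  have S: "?S = ?A \<union> ?B" by auto
  have fin: "finite ?A" "finite ?B"
    by (rule finite_subset[of _ ?S], auto)+
  have "sum ?f ?A = (\<Sum>x\<in>?B. - ?f x)"
    by (rule sum.reindex_bij_witness[of _ "\<lambda>(j, l). (l, j - 1)" "\<lambda>(j, l). (Suc l, j)"])
      (auto simp: G)
  moreover have "sum ?f ?S = sum ?f ?A + sum ?f ?B"
    unfolding S by (rule sum.union_disjoint) (use fin in auto)
  ultimately show ?thesis by (simp add: sum_negf sum.cartesian_product)
qed

lemma face_face: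
  assumes "j \<le> l" "Suc l < length xs"
  shows "face l (face j xs) = face j (face (Suc l) xs)"
  using assms by (auto simp: take_drop)

lemma face_in_ordered_cliques:
  assumes K: "clique_complex d V K" and k: "0 \<le> k"
    and xs: "xs \<in> ordered_cliques K (k + 1)" and j: "j < length xs"
  shows "face j xs \<in> ordered_cliques K k"
proof -
  have len: "int (length xs) = k + 2" using xs by (simp add: ordered_cliques_def)
  have "set (face j xs) \<subseteq> set xs" by (auto dest: in_set_takeD in_set_dropD)
  moreover have "face j xs \<noteq> []" using len k j by (cases xs) auto
  ultimately have "set (face j xs) \<in> K"
    using K xs unfolding clique_complex_def ordered_cliques_def by (metis (mono_tags, lifting) mem_Collect_eq set_empty)
  moreover have "distinct (face j xs)"
    using xs set_take_disj_set_drop_if_distinct[of xs j "Suc j"] by (auto simp: ordered_cliques_def)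
  ultimately show ?thesis using len j by (simp add: ordered_cliques_def)
qed

text \<open>
  Degree \<open>-1\<close> is included since the Laplacian on \<open>0\<close>-cochains involves the coboundary from degree
  \<open>-1\<close> to degree \<open>0\<close>.
\<close>

lemma coboundary_coboundary:
  assumes K: "clique_complex d V K" and k: "-1 \<le> k"
  shows "coboundary K (k + 1) (coboundary K k \<phi>) xs = 0"
proof (cases "xs \<in> ordered_cliques K (k + 1 + 1)")
  case True
  then obtain n where n: "length xs = Suc n" using k
    by (cases "length xs") (auto simp: ordered_cliques_def)
  have "coboundary K (k + 1) (coboundary K k \<phi>) xs =
      (\<Sum>j<Suc n. (-1) ^ j * coboundary K k \<phi> (face j xs))"
    using True n by (simp add: coboundary_def del: sum.lessThan_Suc)
  also have "\<dots> = (\<Sum>j<Suc n. \<Sum>l<n. (-1) ^ j * (-1) ^ l * \<phi> (face l (face j xs)))"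
  proof (rule sum.cong[OF refl])
    fix j assume "j \<in> {..<Suc n}"
    then have j: "j < length xs" using n by simp
    then have len: "length (face j xs) = n" using n by simp
    have "face j xs \<in> ordered_cliques K (k + 1)"
      using face_in_ordered_cliques[OF K _ True j] k by simp
    then have "coboundary K k \<phi> (face j xs) = (\<Sum>l<n. (-1) ^ l * \<phi> (face l (face j xs)))"
      unfolding coboundary_def len by simp
    then show "(-1) ^ j * coboundary K k \<phi> (face j xs)
        = (\<Sum>l<n. (-1) ^ j * (-1) ^ l * \<phi> (face l (face j xs)))"
      by (simp add: sum_distrib_left mult.assoc)
  qed
  also have "\<dots> = 0"
    using n by (intro alternating_double_sum_eq_0 arg_cong[of _ _ \<phi>] face_face) simp_all
  finally show ?thesis .
qed (simp add: coboundary_def)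

lemma cob_mat_cob_mat:
  assumes K: "clique_complex d V K" and k: "-1 \<le> k" and ori: "\<And>k. is_orientation K k (ori k)"
  shows "cob_mat K ori (k + 1) * cob_mat K ori k = 0\<^sub>m (dimC ori (k + 1 + 1)) (dimC ori k)"
proof (rule eq_matI)
  let ?M = "cob_mat K ori (k + 1)" and ?N = "cob_mat K ori k"
  have dims: "?M \<in> carrier_mat (dimC ori (k + 1 + 1)) (dimC ori (k + 1))"
    "?N \<in> carrier_mat (dimC ori (k + 1)) (dimC ori k)" by (simp_all add: cob_mat_def)
  fix i j assume "i < dim_row (0\<^sub>m (dimC ori (k + 1 + 1)) (dimC ori k) :: real mat)"
    "j < dim_col (0\<^sub>m (dimC ori (k + 1 + 1)) (dimC ori k) :: real mat)"
  then have ij: "i < dimC ori (k + 1 + 1)" "j < dimC ori k" by auto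
  let ?e = "unit_vec (dimC ori k) j :: real vec"
  define \<phi> where "\<phi> = cochain_of K ori k ?e"
  have \<phi>: "\<phi> \<in> cochains K k" "coords ori k \<phi> = ?e"
    unfolding \<phi>_def by (rule cochain_of[OF ori]; simp)+
  have "?M *\<^sub>v (?N *\<^sub>v ?e) = coords ori (k + 1 + 1) (coboundary K (k + 1) (coboundary K k \<phi>))"
    using coords_coboundary[of K k ori, OF ori \<phi>(1)]
      coords_coboundary[of K "k + 1" ori, OF ori coboundary_in_cochains[OF \<phi>(1)]] \<phi>(2) by simp
  then have "(?M *\<^sub>v (?N *\<^sub>v ?e)) $ i = 0"
    using ij by (simp add: coords_def coboundary_coboundary[OF K k])
  moreover have "?M *\<^sub>v (?N *\<^sub>v ?e) = (?M * ?N) *\<^sub>v ?e"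
    using dims by (simp add: assoc_mult_mat_vec[OF dims])
  ultimately show "(?M * ?N) $$ (i, j) = 0\<^sub>m (dimC ori (k + 1 + 1)) (dimC ori k) $$ (i, j)"
    using dims ij by (simp del: assoc_mult_mat_vec)
qed (simp_all add: cob_mat_def)


section \<open>Generalized inverses\<close>

text \<open>
  If \<open>R\<close> is the reduced row echelon form of \<open>A\<close>, the matrix \<open>Q\<close> that sends the \<open>i\<close>-th unit vector
  to the unit vector of the pivot column of row \<open>i\<close> (and to \<open>0\<close> for a zero row) satisfies $RQR = R$,
  because \<open>R * Q\<close> is the projection onto the coordinates of the nonzero rows. Undoing the row
  operations gives \<open>G\<close>.
\<close>

lemma generalized_inverse:
  fixes A :: "'a :: field mat"
  assumes A: "A \<in> carrier_mat nr nc"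
  obtains G where "G \<in> carrier_mat nc nr" "A * G * A = A"
proof -
  define R where "R = gauss_jordan_single A"
  note gj = gauss_jordan_single[OF A R_def[symmetric]]
  obtain P P' where P: "R = P * A" "P \<in> carrier_mat nr nr" "P' \<in> carrier_mat nr nr" "P' * P = 1\<^sub>m nr"
    using gj(4) by blast
  have R: "R \<in> carrier_mat nr nc" by (rule gj(2))
  obtain f where "pivot_fun R f nc"
    using gj(3) R unfolding row_echelon_form_def by auto
  note piv = pivot_funD[OF _ this, of nr]
  (* The pivot function takes the value nc on zero rows, so their columns of Q vanish. *)
  define Q where "Q = mat nc nr (\<lambda>(j, i). if f i = j then 1 else 0 :: 'a)"
  have Q: "Q \<in> carrier_mat nc nr" by (simp add: Q_def)
  have RQ: "(R * Q) $$ (i, i') = (if i = i' \<and> f i < nc then 1 else 0)" if "i < nr" "i' < nr" for i i'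
  proof -
    have "(R * Q) $$ (i, i') = (\<Sum>j\<in>{0..<nc}. R $$ (i, j) * (if f i' = j then 1 else 0))"
      using that R by (simp add: scalar_prod_def Q_def)
    also have "\<dots> = (\<Sum>j\<in>{0..<nc}. if f i' = j then R $$ (i, f i') else 0)"
      by (intro sum.cong) auto
    also have "\<dots> = (if f i' < nc then R $$ (i, f i') else 0)" by (simp add: sum.delta)
    also have "\<dots> = (if i = i' \<and> f i < nc then 1 else 0)"
      using that piv(4)[of i'] piv(5)[of i' i] R by auto
    finally show ?thesis .
  qed
  have RQR: "R * Q * R = R"
  proof (rule eq_matI)
    fix i j assume "i < dim_row R" "j < dim_col R"
    then have ij: "i < nr" "j < nc" using R by auto
    have mult: "(T * R) $$ (i, j) = (\<Sum>l\<in>{0..<nr}. T $$ (i, l) * R $$ (l, j))"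
      if "T \<in> carrier_mat nr nr" for T
      using that ij R by (simp add: scalar_prod_def)
    have "(R * Q * R) $$ (i, j) = (\<Sum>l\<in>{0..<nr}. (R * Q) $$ (i, l) * R $$ (l, j))"
      by (rule mult[OF mult_carrier_mat[OF R Q]])
    also have "\<dots> = (\<Sum>l\<in>{0..<nr}. if i = l then (if f i < nc then R $$ (i, j) else 0) else 0)"
      using ij by (intro sum.cong) (auto simp: RQ)
    also have "\<dots> = (if f i < nc then R $$ (i, j) else 0)" using ij by (simp add: sum.delta)
    also have "\<dots> = R $$ (i, j)"
      using piv(1)[of i] piv(2)[of i j] ij R by auto
    finally show "(R * Q * R) $$ (i, j) = R $$ (i, j)" .
  qed (use R Q in auto)
  have A_eq: "A = P' * R"
    using P A by (metis assoc_mult_mat left_mult_one_mat)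
  have "A * (Q * P) * A = P' * (R * Q * R)"
  proof -
    have "A * (Q * P) * A = A * (Q * (P * A))"
      using A Q P by (simp add: assoc_mult_mat[of _ nr nc _ nr _ nc] assoc_mult_mat[of _ nc nr _ nr _ nc])
    also have "\<dots> = P' * R * (Q * R)" using A_eq P(1) by simp
    also have "\<dots> = P' * (R * Q * R)"
      using P Q R by (simp add: assoc_mult_mat[of _ nr nr _ nc _ nc] assoc_mult_mat[of _ nr nc _ nr _ nc])
    finally show ?thesis .
  qed
  then have "A * (Q * P) * A = A" using RQR A_eq by simp
  moreover have "Q * P \<in> carrier_mat nc nr" using Q P by simp
  ultimately show ?thesis using that by blast
qed


section \<open>Weighted inner products and adjoints\<close>

definition wip :: "(nat \<Rightarrow> real) \<Rightarrow> real vec \<Rightarrow> real vec \<Rightarrow> real" where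
  "wip w x y = (\<Sum>i<dim_vec x. w i * (x $ i * y $ i))"

definition wnrm :: "(nat \<Rightarrow> real) \<Rightarrow> real vec \<Rightarrow> real" where
  "wnrm w x = sqrt (wip w x x)"

text \<open>
  For $A : \mathbb{R}^n \to \mathbb{R}^m$ with weights \<open>v\<close> on the source and \<open>w\<close> on the target, this is
  the adjoint $\mathrm{diag}(v)^{-1} A^T \mathrm{diag}(w)$, see \<open>wip_mult_mat_vec\<close>.
\<close>

definition wadj :: "(nat \<Rightarrow> real) \<Rightarrow> (nat \<Rightarrow> real) \<Rightarrow> real mat \<Rightarrow> real mat" where
  "wadj v w A = mat (dim_col A) (dim_row A) (\<lambda>(i, j). w j * A $$ (j, i) / v i)"

abbreviation pos_weight :: "nat \<Rightarrow> (nat \<Rightarrow> real) \<Rightarrow> bool" where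
  "pos_weight n v \<equiv> \<forall>i<n. 0 < v i"

lemma wadj_carrier [simp]: "A \<in> carrier_mat m n \<Longrightarrow> wadj v w A \<in> carrier_mat n m"
  by (simp add: wadj_def)

lemma wip_mult_mat_vec:
  assumes A: "A \<in> carrier_mat m n" and x: "x \<in> carrier_vec n" and y: "y \<in> carrier_vec m"
    and v: "pos_weight n v"
  shows "wip w (A *\<^sub>v x) y = wip v x (wadj v w A *\<^sub>v y)"
proof -
  have "wip w (A *\<^sub>v x) y = (\<Sum>i<m. \<Sum>j<n. w i * A $$ (i, j) * x $ j * y $ i)"
    using A x y by (simp add: wip_def scalar_prod_def lessThan_atLeast0 sum_distrib_left
        sum_distrib_right mult.assoc)
  also have "\<dots> = (\<Sum>j<n. \<Sum>i<m. w i * A $$ (i, j) * x $ j * y $ i)"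
    by (rule sum.swap)
  also have "\<dots> = (\<Sum>j<n. \<Sum>i<m. v j * (x $ j * (w i * A $$ (i, j) / v j * y $ i)))"
    using v by (intro sum.cong refl) (simp add: less_imp_neq[symmetric])
  also have "\<dots> = wip v x (wadj v w A *\<^sub>v y)"
    using A x y by (simp add: wip_def wadj_def scalar_prod_def lessThan_atLeast0 sum_distrib_left)
  finally show ?thesis .
qed

lemma wip_commute: "dim_vec x = dim_vec y \<Longrightarrow> wip w x y = wip w y x"
  by (simp add: wip_def mult.commute)

lemma wip_mult_mat_vec_right:
  assumes A: "A \<in> carrier_mat m n" and x: "x \<in> carrier_vec n" and y: "y \<in> carrier_vec m"
    and v: "pos_weight n v"
  shows "wip w y (A *\<^sub>v x) = wip v (wadj v w A *\<^sub>v y) x"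
  using wip_mult_mat_vec[OF assms, of w] A x y
  by (simp add: wip_commute[of "A *\<^sub>v x"] wip_commute[of x] wadj_def)

lemma wip_add_right:
  assumes "x \<in> carrier_vec n" "y \<in> carrier_vec n" "z \<in> carrier_vec n"
  shows "wip w x (y + z) = wip w x y + wip w x z"
  using assms by (simp add: wip_def algebra_simps sum.distrib)

lemma wip_zero_right [simp]: "x \<in> carrier_vec n \<Longrightarrow> wip w x (0\<^sub>v n) = 0"
  by (simp add: wip_def)

lemma wip_nonneg: "x \<in> carrier_vec n \<Longrightarrow> pos_weight n v \<Longrightarrow> 0 \<le> wip v x x"
  unfolding wip_def by (intro sum_nonneg mult_nonneg_nonneg[OF _ zero_le_square]) (simp add: less_imp_le)

lemma wip_eq_0_imp:
  assumes "x \<in> carrier_vec n" "pos_weight n v" "wip v x x = 0"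
  shows "x = 0\<^sub>v n"
proof (rule eq_vecI)
  fix i assume "i < dim_vec (0\<^sub>v n :: real vec)"
  then have i: "i < n" by simp
  have "\<forall>i\<in>{..<n}. v i * (x $ i * x $ i) = 0"
    using assms by (subst sum_nonneg_eq_0_iff[symmetric])
      (simp_all add: wip_def less_imp_le)
  moreover have "v i \<noteq> 0" using i assms(2) by auto
  ultimately show "x $ i = 0\<^sub>v n $ i" using i by auto
qed (use assms in simp)

lemma wadj_wadj:
  assumes "A \<in> carrier_mat m n" "pos_weight n v" "pos_weight m w"
  shows "wadj w v (wadj v w A) = A"
  using assms by (intro eq_matI) (auto simp: wadj_def less_imp_neq[symmetric])

lemma wadj_mult:
  assumes A: "A \<in> carrier_mat m n" and B: "B \<in> carrier_mat n p" and v: "pos_weight n v"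
  shows "wadj u w (A * B) = wadj u v B * wadj v w A"
proof (rule eq_matI)
  fix i j assume "i < dim_row (wadj u v B * wadj v w A)" "j < dim_col (wadj u v B * wadj v w A)"
  then have ij: "i < p" "j < m" using A B by (auto simp: wadj_def)
  have "wadj u w (A * B) $$ (i, j) = (\<Sum>l<n. w j * (A $$ (j, l) * B $$ (l, i)) / u i)"
    using A B ij by (simp add: wadj_def scalar_prod_def lessThan_atLeast0 sum_distrib_left sum_divide_distrib)
  also have "\<dots> = (\<Sum>l<n. v l * B $$ (l, i) / u i * (w j * A $$ (j, l) / v l))"
    using v by (intro sum.cong refl) (simp add: less_imp_neq[symmetric] field_simps)
  also have "\<dots> = (wadj u v B * wadj v w A) $$ (i, j)"
    using A B ij by (simp add: wadj_def scalar_prod_def lessThan_atLeast0)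
  finally show "wadj u w (A * B) $$ (i, j) = (wadj u v B * wadj v w A) $$ (i, j)" .
qed (use A B in \<open>auto simp: wadj_def\<close>)

lemma wadj_add:
  assumes "A \<in> carrier_mat m n" "B \<in> carrier_mat m n"
  shows "wadj v w (A + B) = wadj v w A + wadj v w B"
  using assms by (intro eq_matI) (auto simp: wadj_def algebra_simps add_divide_distrib)

lemma wadj_zero [simp]: "wadj v w (0\<^sub>m m n) = 0\<^sub>m n m"
  by (intro eq_matI) (auto simp: wadj_def)

text \<open>
  If $A^*Ax = 0$ then $(Ax, Ax) = (x, A^*Ax) = 0$. This is what allows factors \<open>L\<close> to be cancelled from
  $LLx = 0$ when \<open>L\<close> is self-adjoint.
\<close>

lemma wadj_mult_eq_0_imp:
  assumes A: "A \<in> carrier_mat m n" and x: "x \<in> carrier_vec n"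
    and v: "pos_weight n v" and w: "pos_weight m w"
    and 0: "wadj v w A *\<^sub>v (A *\<^sub>v x) = 0\<^sub>v n"
  shows "A *\<^sub>v x = 0\<^sub>v m"
proof (rule wip_eq_0_imp[OF _ w])
  show "wip w (A *\<^sub>v x) (A *\<^sub>v x) = 0"
    using wip_mult_mat_vec[OF A x _ v, of "A *\<^sub>v x" w] A x 0 by simp
qed (use A x in simp)

text \<open>
  Rescaling coordinates by the square roots of the weights makes the weighted norm Euclidean, so
  the triangle and Cauchy-Schwarz inequalities carry over.
\<close>

lemma wnrm_eq_L2_set:
  assumes "x \<in> carrier_vec n" "pos_weight n v"
  shows "wnrm v x = L2_set (\<lambda>i. sqrt (v i) * x $ i) {..<n}"
  using assms by (auto simp: wnrm_def wip_def L2_set_def power2_eq_square power_mult_distrib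
      intro!: arg_cong[of _ _ sqrt] sum.cong)

lemma wnrm_nonneg: "x \<in> carrier_vec n \<Longrightarrow> pos_weight n v \<Longrightarrow> 0 \<le> wnrm v x"
  by (simp add: wnrm_def wip_nonneg)

lemma wnrm_triangle:
  assumes "x \<in> carrier_vec n" "y \<in> carrier_vec n" "pos_weight n v"
  shows "wnrm v (x + y) \<le> wnrm v x + wnrm v y"
proof -
  have "wnrm v (x + y) = L2_set (\<lambda>i. sqrt (v i) * x $ i + sqrt (v i) * y $ i) {..<n}"
    using assms by (simp add: wnrm_eq_L2_set[of _ n]) (intro L2_set_cong, auto simp: algebra_simps)
  then show ?thesis
    using assms L2_set_triangle_ineq by (simp add: wnrm_eq_L2_set[of _ n])
qed

lemma wip_le_wnrm_mult:
  assumes "x \<in> carrier_vec n" "y \<in> carrier_vec n" "pos_weight n v"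
  shows "wip v x y \<le> wnrm v x * wnrm v y"
proof -
  have "wip v x y = (\<Sum>i<n. (sqrt (v i) * x $ i) * (sqrt (v i) * y $ i))"
    using assms by (auto simp: wip_def intro!: sum.cong)
  also have "\<dots> \<le> (\<Sum>i<n. \<bar>sqrt (v i) * x $ i\<bar> * \<bar>sqrt (v i) * y $ i\<bar>)"
    by (intro sum_mono) (simp flip: abs_mult)
  also have "\<dots> \<le> wnrm v x * wnrm v y"
    using assms by (simp only: wnrm_eq_L2_set[of _ n] L2_set_mult_ineq)
  finally show ?thesis .
qed

lemma mult_mat_vec_bounded:
  assumes G: "G \<in> carrier_mat n m" and v: "pos_weight n v" and w: "pos_weight m w"
  obtains c where "\<And>y. y \<in> carrier_vec m \<Longrightarrow> wnrm v (G *\<^sub>v y) \<le> c * wnrm w y"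
proof
  let ?c = "\<Sum>i<n. \<Sum>j<m. sqrt (v i) * (\<bar>G $$ (i, j)\<bar> / sqrt (w j))"
  fix y :: "real vec" assume y: "y \<in> carrier_vec m"
  have y_le: "\<bar>y $ j\<bar> \<le> wnrm w y / sqrt (w j)" if j: "j < m" for j
  proof -
    have "\<bar>sqrt (w j) * y $ j\<bar> \<le> L2_set (\<lambda>i. \<bar>sqrt (w i) * y $ i\<bar>) {..<m}"
      by (rule member_le_L2_set) (use j in auto)
    also have "\<dots> = wnrm w y"
      using y w by (simp add: wnrm_eq_L2_set[of _ m]) (simp add: L2_set_def)
    finally show ?thesis using w j by (simp add: abs_mult less_imp_le field_simps)
  qed
  have "wnrm v (G *\<^sub>v y) \<le> (\<Sum>i<n. \<bar>sqrt (v i) * (G *\<^sub>v y) $ i\<bar>)"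
    using G y v by (simp add: wnrm_eq_L2_set[of _ n] L2_set_le_sum_abs del: index_mult_mat_vec)
  also have "\<dots> \<le> (\<Sum>i<n. \<Sum>j<m. sqrt (v i) * (\<bar>G $$ (i, j)\<bar> / sqrt (w j)) * wnrm w y)"
  proof (rule sum_mono)
    fix i assume "i \<in> {..<n}"
    then have i: "i < n" by simp
    have "(G *\<^sub>v y) $ i = (\<Sum>j<m. G $$ (i, j) * y $ j)"
      using G y i by (simp add: scalar_prod_def lessThan_atLeast0)
    then have "\<bar>(G *\<^sub>v y) $ i\<bar> \<le> (\<Sum>j<m. \<bar>G $$ (i, j)\<bar> * \<bar>y $ j\<bar>)"
      by (metis (no_types, lifting) abs_mult sum.cong sum_abs)
    also have "\<dots> \<le> (\<Sum>j<m. \<bar>G $$ (i, j)\<bar> * (wnrm w y / sqrt (w j)))"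
      by (intro sum_mono mult_left_mono y_le) auto
    finally have "sqrt (v i) * \<bar>(G *\<^sub>v y) $ i\<bar> \<le> sqrt (v i) * (\<Sum>j<m. \<bar>G $$ (i, j)\<bar> * (wnrm w y / sqrt (w j)))"
      using v i by (intro mult_left_mono) (auto simp: less_imp_le)
    then show "\<bar>sqrt (v i) * (G *\<^sub>v y) $ i\<bar> \<le> (\<Sum>j<m. sqrt (v i) * (\<bar>G $$ (i, j)\<bar> / sqrt (w j)) * wnrm w y)"
      using v i by (simp add: abs_mult sum_distrib_left less_imp_le mult.assoc del: index_mult_mat_vec)
  qed
  also have "\<dots> = ?c * wnrm w y" by (simp add: sum_distrib_right)
  finally show "wnrm v (G *\<^sub>v y) \<le> ?c * wnrm w y" .
qed


section \<open>Poincare inequality and Hodge decomposition for weighted adjoints\<close>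

text \<open>
  For \<open>z\<close> in the image of the adjoint, $(z, \cdot)$ only depends on the image under \<open>A\<close>. Since \<open>z\<close>
  and $GAz$ have the same image, $(z,z) = (z,GAz)$, and Cauchy-Schwarz reduces the claim to the
  boundedness of \<open>G\<close>.
\<close>

lemma poincare_wadj:
  assumes A: "A \<in> carrier_mat m n" and v: "pos_weight n v" and w: "pos_weight m w"
  obtains c where
    "\<And>y. y \<in> carrier_vec m \<Longrightarrow> wnrm v (wadj v w A *\<^sub>v y) \<le> c * wnrm w (A *\<^sub>v (wadj v w A *\<^sub>v y))"
proof -
  obtain G where G: "G \<in> carrier_mat n m" "A * G * A = A" using generalized_inverse[OF A] .
  obtain c where c: "\<And>y. y \<in> carrier_vec m \<Longrightarrow> wnrm v (G *\<^sub>v y) \<le> c * wnrm w y"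
    using mult_mat_vec_bounded[OF G(1) v w] by blast
  have "wnrm v (wadj v w A *\<^sub>v y) \<le> c * wnrm w (A *\<^sub>v (wadj v w A *\<^sub>v y))"
    if y: "y \<in> carrier_vec m" for y
  proof -
    define z where "z = wadj v w A *\<^sub>v y"
    have z: "z \<in> carrier_vec n" unfolding z_def by (rule mult_mat_vec_carrier[OF wadj_carrier[OF A] y])
    define g where "g = G *\<^sub>v (A *\<^sub>v z)"
    have Az: "A *\<^sub>v z \<in> carrier_vec m" using A z by simp
    have g: "g \<in> carrier_vec n" unfolding g_def using G Az by simp
    have "A *\<^sub>v g = (A * G * A) *\<^sub>v z"
      unfolding g_def assoc_mult_mat_vec[OF mult_carrier_mat[OF A G(1)] A z]
        assoc_mult_mat_vec[OF A G(1) Az] ..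
    then have Ag: "A *\<^sub>v g = A *\<^sub>v z" using G by simp
    have "wip v z g = wip w y (A *\<^sub>v g)"
      unfolding z_def using wip_mult_mat_vec_right[OF A g y v] by simp
    also have "\<dots> = wip v z z"
      unfolding Ag unfolding z_def[symmetric] using wip_mult_mat_vec_right[OF A z y v] by (simp add: z_def)
    finally have "wnrm v z * wnrm v z \<le> wnrm v z * wnrm v g"
      using wip_le_wnrm_mult[OF z g v] wip_nonneg[OF z v] by (simp add: wnrm_def)
    then have "wnrm v z \<le> wnrm v g"
      using wnrm_nonneg[OF z v] wnrm_nonneg[OF g v] by (cases "wnrm v z = 0") auto
    also have "\<dots> \<le> c * wnrm w (A *\<^sub>v z)" unfolding g_def using c Az by simp
    finally show ?thesis unfolding z_def .
  qed
  then show ?thesis using that by blast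
qed

lemma eq_mat_if_mult_mat_vec_eq:
  fixes A B :: "'a :: semiring_1 mat"
  assumes A: "A \<in> carrier_mat m n" and B: "B \<in> carrier_mat m n"
    and eq: "\<And>x. x \<in> carrier_vec n \<Longrightarrow> A *\<^sub>v x = B *\<^sub>v x"
  shows "A = B"
proof (rule eq_matI)
  fix i j assume "i < dim_row B" "j < dim_col B"
  then show "A $$ (i, j) = B $$ (i, j)"
    using A B arg_cong[OF eq[of "unit_vec n j"], of "\<lambda>x. x $ i"] by auto
qed (use A B in auto)

text \<open>
  Let \<open>H\<close> be a generalized inverse of $L^2$. From $L^2(HL^2 - 1) = 0$ one factor \<open>L\<close> cancels because
  \<open>L\<close> is self-adjoint, which leaves $LHL^2 = L$. The adjoint of this equation is $L^2H^*L = L$, so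
  $x = H^*Lu$ is a solution.
\<close>

lemma self_adjoint_square_solvable:
  assumes L: "L \<in> carrier_mat n n" and v: "pos_weight n v" and sa: "wadj v v L = L"
    and u: "u \<in> carrier_vec n"
  obtains x where "x \<in> carrier_vec n" "L *\<^sub>v (L *\<^sub>v x) = L *\<^sub>v u"
proof -
  let ?S = "L * L"
  have S: "?S \<in> carrier_mat n n" using L by simp
  obtain H where H: "H \<in> carrier_mat n n" "?S * H * ?S = ?S" using generalized_inverse[OF S] .
  have "L * (H * ?S) = L"
  proof -
    have HS: "H * ?S \<in> carrier_mat n n" using H S by simp
    have "(L * (H * ?S)) *\<^sub>v y = L *\<^sub>v y" if y: "y \<in> carrier_vec n" for y
    proof -
      let ?y = "(H * ?S) *\<^sub>v y - y"
      have Hy: "(H * ?S) *\<^sub>v y \<in> carrier_vec n" using mult_mat_vec_carrier[OF HS y] .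
      have y': "?y \<in> carrier_vec n" using Hy y by simp
      have "?S *\<^sub>v ((H * ?S) *\<^sub>v y) = (?S * (H * ?S)) *\<^sub>v y"
        by (rule assoc_mult_mat_vec[OF S HS y, symmetric])
      also have "?S * (H * ?S) = ?S" using H(2) assoc_mult_mat[OF S H(1) S] by simp
      finally have "?S *\<^sub>v ?y = 0\<^sub>v n"
        using S y mult_mat_vec_carrier[OF S y] by (simp add: mult_minus_distrib_mat_vec[OF S Hy y] del: assoc_mult_mat_vec)
      then have "wadj v v L *\<^sub>v (L *\<^sub>v ?y) = 0\<^sub>v n"
        using assoc_mult_mat_vec[OF L L y'] sa by simp
      then have "L *\<^sub>v ?y = 0\<^sub>v n" using wadj_mult_eq_0_imp[OF L y' v v] by simp
      then have "L *\<^sub>v ((H * ?S) *\<^sub>v y) - L *\<^sub>v y = 0\<^sub>v n"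
        using mult_minus_distrib_mat_vec[OF L Hy y] by simp
      then have "L *\<^sub>v ((H * ?S) *\<^sub>v y) = L *\<^sub>v y"
        using mult_mat_vec_carrier[OF L y] mult_mat_vec_carrier[OF L Hy]
        by (intro eq_vecI) (auto dest!: arg_cong[of _ _ "\<lambda>v. v $ _"] simp: vec_eq_iff)
      then show ?thesis using assoc_mult_mat_vec[OF L HS y] by simp
    qed
    then show ?thesis using L HS by (intro eq_mat_if_mult_mat_vec_eq[of _ n n]) auto
  qed
  then have "wadj v v L = wadj v v (L * (H * ?S))" by simp
  also have "\<dots> = wadj v v ?S * wadj v v H * wadj v v L"
    using wadj_mult[OF L mult_carrier_mat[OF H(1) S] v, of v v] wadj_mult[OF H(1) S v, of v v] by simp
  also have "wadj v v ?S = ?S" using wadj_mult[OF L L v, of v v] sa by simp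
  finally have eq: "L = ?S * wadj v v H * L" using sa by simp
  define x where "x = wadj v v H *\<^sub>v (L *\<^sub>v u)"
  have H': "wadj v v H \<in> carrier_mat n n" using H by simp
  have Lu: "L *\<^sub>v u \<in> carrier_vec n" using L u by simp
  have x: "x \<in> carrier_vec n" unfolding x_def using mult_mat_vec_carrier[OF H' Lu] .
  have "L *\<^sub>v (L *\<^sub>v x) = ?S *\<^sub>v (wadj v v H *\<^sub>v (L *\<^sub>v u))"
    using assoc_mult_mat_vec[OF L L x] by (simp add: x_def)
  also have "\<dots> = (?S * wadj v v H * L) *\<^sub>v u"
    using assoc_mult_mat_vec[OF S H' Lu] assoc_mult_mat_vec[OF mult_carrier_mat[OF S H'] L u] by simp
  also have "\<dots> = L *\<^sub>v u" using eq by simp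
  finally show ?thesis using that x by blast
qed

text \<open>
  With $L = AA^* + B^*B$ and $LLy = Lx$, the vector $h = x - Ly$ is in the kernel of \<open>L\<close>. Both
  $A^*h$ and $Bh$ vanish because $0 = (h, Lh) = (A^*h, A^*h) + (Bh, Bh)$.
\<close>

lemma hodge_decomposition:
  assumes A: "A \<in> carrier_mat n p" and B: "B \<in> carrier_mat m n"
    and u: "pos_weight p u" and v: "pos_weight n v" and w: "pos_weight m w"
    and x: "x \<in> carrier_vec n"
  defines "A' \<equiv> wadj u v A" and "B' \<equiv> wadj v w B"
  obtains h y where "h \<in> carrier_vec n" "y \<in> carrier_vec n"
    "(A * A' + B' * B) *\<^sub>v h = 0\<^sub>v n" "A' *\<^sub>v h = 0\<^sub>v p" "B *\<^sub>v h = 0\<^sub>v m"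
    "x = h + (A *\<^sub>v (A' *\<^sub>v y) + B' *\<^sub>v (B *\<^sub>v y))"
proof -
  have A': "A' \<in> carrier_mat p n" and B': "B' \<in> carrier_mat n m"
    unfolding A'_def B'_def using A B by simp_all
  define L where "L = A * A' + B' * B"
  have L: "L \<in> carrier_mat n n" unfolding L_def using A A' B B' by simp
  have AA: "A * A' \<in> carrier_mat n n" and BB: "B' * B \<in> carrier_mat n n"
    using A A' B B' by simp_all
  have L_vec: "L *\<^sub>v z = A *\<^sub>v (A' *\<^sub>v z) + B' *\<^sub>v (B *\<^sub>v z)" if z: "z \<in> carrier_vec n" for z
    unfolding L_def add_mult_distrib_mat_vec[OF AA BB z]
      assoc_mult_mat_vec[OF A A' z] assoc_mult_mat_vec[OF B' B z] ..
  have "wadj v v L = L"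
    unfolding L_def wadj_add[OF AA BB] wadj_mult[OF A A' u] wadj_mult[OF B' B w]
    by (simp add: A'_def B'_def wadj_wadj[OF A u v] wadj_wadj[OF B v w])
  then obtain y where y: "y \<in> carrier_vec n" "L *\<^sub>v (L *\<^sub>v y) = L *\<^sub>v x"
    using self_adjoint_square_solvable[OF L v _ x] by blast
  have Ly: "L *\<^sub>v y \<in> carrier_vec n" using mult_mat_vec_carrier[OF L y(1)] .
  define h where "h = x - L *\<^sub>v y"
  have h: "h \<in> carrier_vec n" unfolding h_def using x Ly by simp
  have Lh: "L *\<^sub>v h = 0\<^sub>v n"
    unfolding h_def mult_minus_distrib_mat_vec[OF L x Ly] y(2)
    using mult_mat_vec_carrier[OF L x] by simp
  have A'h: "A' *\<^sub>v h \<in> carrier_vec p" and Bh: "B *\<^sub>v h \<in> carrier_vec m"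
    using A' B h by simp_all
  have "0 = wip v h (L *\<^sub>v h)" using Lh h by simp
  also have "\<dots> = wip v h (A *\<^sub>v (A' *\<^sub>v h)) + wip v h (B' *\<^sub>v (B *\<^sub>v h))"
    unfolding L_vec[OF h]
    using wip_add_right[OF h mult_mat_vec_carrier[OF A A'h] mult_mat_vec_carrier[OF B' Bh]] .
  also have "wip v h (A *\<^sub>v (A' *\<^sub>v h)) = wip u (A' *\<^sub>v h) (A' *\<^sub>v h)"
    using wip_mult_mat_vec_right[OF A A'h h u] by (simp add: A'_def)
  also have "wip v h (B' *\<^sub>v (B *\<^sub>v h)) = wip w (B *\<^sub>v h) (B *\<^sub>v h)"
    using wip_mult_mat_vec[OF B h Bh v] by (simp add: B'_def)
  finally have "wip u (A' *\<^sub>v h) (A' *\<^sub>v h) = 0" "wip w (B *\<^sub>v h) (B *\<^sub>v h) = 0"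
    using wip_nonneg[OF A'h u] wip_nonneg[OF Bh w] by simp_all
  then have "A' *\<^sub>v h = 0\<^sub>v p" "B *\<^sub>v h = 0\<^sub>v m"
    using wip_eq_0_imp[OF A'h u] wip_eq_0_imp[OF Bh w] by simp_all
  moreover have "x = h + L *\<^sub>v y"
    unfolding h_def using x carrier_vecD[OF Ly] by (intro eq_vecI) simp_all
  ultimately show ?thesis using that[OF h y(1)] Lh L_vec[OF y(1)] unfolding L_def by simp
qed

section \<open>The weighted cochain complex\<close>

lemma pos_diag_mult_index:
  assumes "pos_diag m A" "M \<in> carrier_mat m n" "i < m" "j < n"
  shows "(A * M) $$ (i, j) = A $$ (i, i) * M $$ (i, j)"
proof -
  have "(A * M) $$ (i, j) = (\<Sum>l\<in>{0..<m}. A $$ (i, l) * M $$ (l, j))"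
    using assms by (auto simp: pos_diag_def scalar_prod_def)
  also have "\<dots> = (\<Sum>l\<in>{0..<m}. if i = l then A $$ (i, i) * M $$ (i, j) else 0)"
    using assms by (intro sum.cong) (auto simp: pos_diag_def diagonal_mat_def)
  finally show ?thesis using assms(3) by simp
qed

lemma minv_index:
  assumes A: "pos_diag n A" and ij: "i < n" "j < n"
  shows "minv A $$ (i, j) = (if i = j then 1 / A $$ (i, i) else 0)"
proof -
  have "A $$ (i, i) * minv A $$ (i, j) = (if i = j then 1 else 0)"
    using pos_diag_mult_index[OF A minv(1)[OF A] ij] minv(2)[OF A] ij by simp
  moreover have "A $$ (i, i) \<noteq> 0" using A ij by (auto simp: pos_diag_def)
  ultimately show ?thesis by (auto simp: field_simps)
qed

lemma mult_minv_index:
  assumes A: "pos_diag n A" and M: "M \<in> carrier_mat m n" and ij: "i < m" "j < n"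
  shows "(M * minv A) $$ (i, j) = M $$ (i, j) / A $$ (j, j)"
proof -
  have "(M * minv A) $$ (i, j) = (\<Sum>l\<in>{0..<n}. M $$ (i, l) * minv A $$ (l, j))"
    using M minv(1)[OF A] ij by (auto simp: scalar_prod_def)
  also have "\<dots> = (\<Sum>l\<in>{0..<n}. if l = j then M $$ (i, j) / A $$ (j, j) else 0)"
    using ij by (intro sum.cong) (auto simp: minv_index[OF A])
  finally show ?thesis using ij by simp
qed

lemma mult_pos_diag_index:
  assumes A: "pos_diag n A" and M: "M \<in> carrier_mat m n" and ij: "i < m" "j < n"
  shows "(M * A) $$ (i, j) = M $$ (i, j) * A $$ (j, j)"
proof -
  have "(M * A) $$ (i, j) = (\<Sum>l\<in>{0..<n}. M $$ (i, l) * A $$ (l, j))"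
    using A M ij by (auto simp: pos_diag_def scalar_prod_def)
  also have "\<dots> = (\<Sum>l\<in>{0..<n}. if l = j then M $$ (i, j) * A $$ (j, j) else 0)"
    using A ij by (intro sum.cong) (auto simp: pos_diag_def diagonal_mat_def)
  finally show ?thesis using ij by simp
qed

lemma minv_mult_index:
  assumes A: "pos_diag m A" and M: "M \<in> carrier_mat m n" and ij: "i < m" "j < n"
  shows "(minv A * M) $$ (i, j) = M $$ (i, j) / A $$ (i, i)"
proof -
  have "(minv A * M) $$ (i, j) = (\<Sum>l\<in>{0..<m}. minv A $$ (i, l) * M $$ (l, j))"
    using M minv(1)[OF A] ij by (auto simp: scalar_prod_def)
  also have "\<dots> = (\<Sum>l\<in>{0..<m}. if i = l then M $$ (i, j) / A $$ (i, i) else 0)"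
    using ij by (intro sum.cong) (auto simp: minv_index[OF A])
  finally show ?thesis using ij by simp
qed

text \<open>
  Orientations and diagonal matrices are given in every integer degree. Outside \<open>0..d\<close> all spaces are
  zero, so degrees \<open>0\<close> and \<open>d\<close>, where one of the two neighbouring spaces vanishes, are treated like
  all others.
\<close>

locale weighted_clique_complex =
  fixes d :: nat and V :: "'a set" and K :: "'a set set" and ori :: "int \<Rightarrow> 'a list list"
    and B D :: "int \<Rightarrow> real mat"
  assumes K: "clique_complex d V K"
    and ori: "is_orientation K k (ori k)"
    and B: "pos_diag (dimC ori k) (B k)"
    and D: "pos_diag (dimC ori k) (D k)"
begin

definition weight :: "int \<Rightarrow> nat \<Rightarrow> real" where
  "weight k i = D k $$ (i, i) / B k $$ (i, i)"

lemma weight_pos: "pos_weight (dimC ori k) (weight k)"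
  using B[of k] D[of k] by (simp add: weight_def pos_diag_def)

lemma diag_carrier: "B k \<in> carrier_mat (dimC ori k) (dimC ori k)" "D k \<in> carrier_mat (dimC ori k) (dimC ori k)"
  using B[of k] D[of k] by (simp_all add: pos_diag_def)

lemma cob_mat_carrier: "cob_mat K ori k \<in> carrier_mat (dimC ori (k + 1)) (dimC ori k)"
  by (simp add: cob_mat_def)

lemma dd_carrier: "dd K ori B k \<in> carrier_mat (dimC ori (k + 1)) (dimC ori k)"
  unfolding dd_def using diag_carrier(1)[of "k + 1"] cob_mat_carrier minv(1)[OF B] by (metis mult_carrier_mat)

lemma dd_star_carrier: "dd_star K ori D k \<in> carrier_mat (dimC ori k) (dimC ori (k + 1))"
  unfolding dd_star_def using diag_carrier(2)[of "k + 1"] cob_mat_carrier minv(1)[OF D]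
  by (metis mult_carrier_mat transpose_carrier_mat)

text \<open>
  Both sides have the entry $\delta_{ji} D_{k+1,jj} / D_{k,ii}$ at $(i,j)$, where $\delta$ is the
  coboundary matrix: on the right, the entries of \<open>B\<close> in the weights cancel against those that conjugate the coboundary.
\<close>

lemma dd_star_eq_wadj: "dd_star K ori D k = wadj (weight k) (weight (k + 1)) (dd K ori B k)"
proof (rule eq_matI)
  let ?M = "cob_mat K ori k"
  fix i j assume "i < dim_row (wadj (weight k) (weight (k + 1)) (dd K ori B k))"
    "j < dim_col (wadj (weight k) (weight (k + 1)) (dd K ori B k))"
  then have ij: "i < dimC ori k" "j < dimC ori (k + 1)"
    using dd_carrier[of k] by (auto simp: wadj_def)
  have BM: "B (k + 1) * ?M \<in> carrier_mat (dimC ori (k + 1)) (dimC ori k)"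
    using diag_carrier cob_mat_carrier by (metis mult_carrier_mat)
  have DM: "minv (D k) * transpose_mat ?M \<in> carrier_mat (dimC ori k) (dimC ori (k + 1))"
    using minv(1)[OF D] cob_mat_carrier by (metis mult_carrier_mat transpose_carrier_mat)
  have "dd K ori B k $$ (j, i) = B (k + 1) $$ (j, j) * ?M $$ (j, i) / B k $$ (i, i)"
    unfolding dd_def mult_minv_index[OF B BM ij(2,1)] pos_diag_mult_index[OF B cob_mat_carrier ij(2,1)] ..
  moreover have "transpose_mat ?M $$ (i, j) = ?M $$ (j, i)"
    using ij cob_mat_carrier[of k] by simp
  then have "dd_star K ori D k $$ (i, j) = ?M $$ (j, i) / D k $$ (i, i) * D (k + 1) $$ (j, j)"
    unfolding dd_star_def mult_pos_diag_index[OF D DM ij]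
      minv_mult_index[OF D transpose_carrier_mat[THEN iffD2, OF cob_mat_carrier] ij] by simp
  moreover have "B k $$ (i, i) \<noteq> 0" "B (k + 1) $$ (j, j) \<noteq> 0"
    using B[of k] B[of "k + 1"] ij by (auto simp: pos_diag_def)
  ultimately show "dd_star K ori D k $$ (i, j) = wadj (weight k) (weight (k + 1)) (dd K ori B k) $$ (i, j)"
    using ij dd_carrier[of k] by (simp add: wadj_def weight_def)
qed (use dd_carrier[of k] dd_star_carrier[of k] in \<open>auto simp: wadj_def\<close>)

lemma dd_eq_wadj: "dd K ori B k = wadj (weight (k + 1)) (weight k) (dd_star K ori D k)"
  unfolding dd_star_eq_wadj by (rule wadj_wadj[OF dd_carrier weight_pos weight_pos, symmetric])

text \<open>
  The inner factors $\mathbf{B}_{k+1}^{-1}\mathbf{B}_{k+1}$ cancel, which leaves a product of two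
  consecutive coboundary matrices.
\<close>

lemma dd_dd:
  assumes "-1 \<le> k"
  shows "dd K ori B (k + 1) * dd K ori B k = 0\<^sub>m (dimC ori (k + 1 + 1)) (dimC ori k)"
proof -
  let ?B = B and ?M = "cob_mat K ori k" and ?N = "cob_mat K ori (k + 1)"
  note c = diag_carrier(1)[of k] diag_carrier(1)[of "k + 1"] diag_carrier(1)[of "k + 1 + 1"]
    minv(1)[OF B, of k] minv(1)[OF B, of "k + 1"] cob_mat_carrier[of k] cob_mat_carrier[of "k + 1"]
  have NM: "?N * ?M = 0\<^sub>m (dimC ori (k + 1 + 1)) (dimC ori k)"
    by (rule cob_mat_cob_mat[OF K assms ori])
  have cN: "B (k + 1 + 1) * ?N \<in> carrier_mat (dimC ori (k + 1 + 1)) (dimC ori (k + 1))"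
    and cM: "?M * minv (B k) \<in> carrier_mat (dimC ori (k + 1)) (dimC ori k)"
    using c by (metis mult_carrier_mat)+
  have "dd K ori B (k + 1) * dd K ori B k
      = (B (k + 1 + 1) * ?N) * (minv (B (k + 1)) * (B (k + 1) * (?M * minv (B k))))"
    unfolding dd_def assoc_mult_mat[OF c(2,6,4)]
    by (rule assoc_mult_mat[OF cN c(5) mult_carrier_mat[OF c(2) cM]])
  also have "minv (B (k + 1)) * (B (k + 1) * (?M * minv (B k))) = ?M * minv (B k)"
    unfolding assoc_mult_mat[OF c(5,2) cM, symmetric] minv(3)[OF B] by (rule left_mult_one_mat[OF cM])
  also have "(B (k + 1 + 1) * ?N) * (?M * minv (B k)) = B (k + 1 + 1) * ((?N * ?M) * minv (B k))"
    unfolding assoc_mult_mat[OF c(3,7) cM] assoc_mult_mat[OF c(7,6,4)] ..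
  also have "\<dots> = 0\<^sub>m (dimC ori (k + 1 + 1)) (dimC ori k)"
    unfolding NM left_mult_zero_mat[OF c(4)] by (rule right_mult_zero_mat[OF c(3)])
  finally show ?thesis .
qed

lemma dd_star_dd_star:
  assumes "-1 \<le> k"
  shows "dd_star K ori D k * dd_star K ori D (k + 1) = 0\<^sub>m (dimC ori k) (dimC ori (k + 1 + 1))"
  unfolding dd_star_eq_wadj wadj_mult[OF dd_carrier dd_carrier weight_pos, symmetric] dd_dd[OF assms]
  by (rule wadj_zero)

lemma ip_eq_wip:
  assumes x: "x \<in> carrier_vec (dimC ori k)" and y: "y \<in> carrier_vec (dimC ori k)"
  shows "ip B D k x y = wip (weight k) x y"
proof -
  let ?n = "dimC ori k"
  define W where "W = D k * minv (B k)"
  have W: "W \<in> carrier_mat ?n ?n"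
    unfolding W_def using diag_carrier(2) minv(1)[OF B] by (metis mult_carrier_mat)
  have "(W *\<^sub>v y) $ i = weight k i * y $ i" if i: "i < ?n" for i
  proof -
    have "(W *\<^sub>v y) $ i = (\<Sum>j\<in>{0..<?n}. W $$ (i, j) * y $ j)"
      using W y i by (simp add: scalar_prod_def)
    also have "\<dots> = (\<Sum>j\<in>{0..<?n}. if i = j then weight k i * y $ i else 0)"
      using i D[of k] by (intro sum.cong)
        (auto simp: W_def mult_minv_index[OF B diag_carrier(2)] weight_def pos_diag_def diagonal_mat_def
          simp del: index_mult_mat(1))
    finally show ?thesis using i by simp
  qed
  then show ?thesis
    using x y W unfolding ip_def wip_def scalar_prod_def W_def[symmetric]
    by (auto simp: lessThan_atLeast0 mult.left_commute intro!: sum.cong simp del: index_mult_mat_vec)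
qed

lemma nrm_eq_wnrm: "x \<in> carrier_vec (dimC ori k) \<Longrightarrow> nrm B D k x = wnrm (weight k) x"
  by (simp add: nrm_def wnrm_def ip_eq_wip)

lemma poincare_exists: "\<exists>c. poincare K ori B D k c"
proof -
  obtain c where c: "\<And>y. y \<in> carrier_vec (dimC ori (k + 1)) \<Longrightarrow>
      wnrm (weight k) (dd_star K ori D k *\<^sub>v y)
        \<le> c * wnrm (weight (k + 1)) (dd K ori B k *\<^sub>v (dd_star K ori D k *\<^sub>v y))"
    using poincare_wadj[OF dd_carrier weight_pos weight_pos, of k] unfolding dd_star_eq_wadj by blast
  have "poincare K ori B D k c"
    unfolding poincare_def mat_im_def
  proof clarify
    fix y :: "real vec" assume "y \<in> carrier_vec (dim_col (dd_star K ori D k))"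
    then have y: "y \<in> carrier_vec (dimC ori (k + 1))" using dd_star_carrier[of k] by auto
    have z: "dd_star K ori D k *\<^sub>v y \<in> carrier_vec (dimC ori k)"
      using mult_mat_vec_carrier[OF dd_star_carrier y] .
    show "nrm B D k (dd_star K ori D k *\<^sub>v y)
        \<le> c * nrm B D (k + 1) (dd K ori B k *\<^sub>v (dd_star K ori D k *\<^sub>v y))"
      unfolding nrm_eq_wnrm[OF z] nrm_eq_wnrm[OF mult_mat_vec_carrier[OF dd_carrier z]]
      using c[OF y] .
  qed
  then show ?thesis by blast
qed

lemma poincare_star_exists: "\<exists>c. poincare_star K ori B D k c"
proof -
  define l where "l = k - 1"
  have k: "k = l + 1" by (simp add: l_def)
  obtain c where c: "\<And>y. y \<in> carrier_vec (dimC ori l) \<Longrightarrow>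
      wnrm (weight (l + 1)) (dd K ori B l *\<^sub>v y)
        \<le> c * wnrm (weight l) (dd_star K ori D l *\<^sub>v (dd K ori B l *\<^sub>v y))"
    using poincare_wadj[OF dd_star_carrier weight_pos weight_pos, of l] dd_eq_wadj[of l] by metis
  have "poincare_star K ori B D (l + 1) c"
    unfolding poincare_star_def mat_im_def
  proof clarsimp
    fix y :: "real vec" assume "y \<in> carrier_vec (dim_col (dd K ori B l))"
    then have y: "y \<in> carrier_vec (dimC ori l)" using dd_carrier[of l] by auto
    have z: "dd K ori B l *\<^sub>v y \<in> carrier_vec (dimC ori (l + 1))"
      using mult_mat_vec_carrier[OF dd_carrier y] .
    show "nrm B D (l + 1) (dd K ori B l *\<^sub>v y)
        \<le> c * nrm B D l (dd_star K ori D l *\<^sub>v (dd K ori B l *\<^sub>v y))"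
      unfolding nrm_eq_wnrm[OF z] nrm_eq_wnrm[OF mult_mat_vec_carrier[OF dd_star_carrier z]]
      using c[OF y] .
  qed
  then show ?thesis unfolding k by blast
qed

lemma nrm_nonneg: "x \<in> carrier_vec (dimC ori k) \<Longrightarrow> 0 \<le> nrm B D k x"
  by (simp add: nrm_eq_wnrm wnrm_nonneg[OF _ weight_pos])

text \<open>
  The component \<open>p\<close> in the image of $\mathsf{d}_{k-1}$ is controlled by $\mathsf{d}_{k-1}^*$, and
  the component \<open>q\<close> in the image of $\mathsf{d}_k^*$ by $\mathsf{d}_k$; each operator annihilates the
  other component and the harmonic part, so it takes the same value on \<open>u\<close>.
\<close>

lemma harmonic_distance_bound:
  assumes k: "0 \<le> k" and P: "poincare K ori B D k c" and PS: "poincare_star K ori B D k cs"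
    and u: "u \<in> carrier_vec (dimC ori k)"
  shows "\<exists>h \<in> mat_kernel (laplacian K ori B D k). nrm B D k (u - h)
    \<le> c * nrm B D (k + 1) (dd K ori B k *\<^sub>v u) + cs * nrm B D (k - 1) (dd_star K ori D (k - 1) *\<^sub>v u)"
proof -
  define l where "l = k - 1"
  have kl: "k = l + 1" and l: "-1 \<le> l" using k by (simp_all add: l_def)
  let ?A = "dd K ori B l" and ?A' = "dd_star K ori D l"
    and ?B = "dd K ori B k" and ?B' = "dd_star K ori D k"
  have A: "?A \<in> carrier_mat (dimC ori k) (dimC ori l)" using dd_carrier[of l] by (simp add: kl)
  have A': "?A' \<in> carrier_mat (dimC ori l) (dimC ori k)" using dd_star_carrier[of l] by (simp add: kl)
  note B' = dd_star_carrier[of k] and B = dd_carrier[of k]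
  have adj: "wadj (weight l) (weight k) ?A = ?A'" "wadj (weight k) (weight (k + 1)) ?B = ?B'"
    by (simp_all add: dd_star_eq_wadj kl)
  from hodge_decomposition[OF A B weight_pos weight_pos weight_pos u, unfolded adj]
  obtain h y where h: "h \<in> carrier_vec (dimC ori k)" and y: "y \<in> carrier_vec (dimC ori k)"
    and Lh: "(?A * ?A' + ?B' * ?B) *\<^sub>v h = 0\<^sub>v (dimC ori k)"
    and A'h: "?A' *\<^sub>v h = 0\<^sub>v (dimC ori l)" and Bh: "?B *\<^sub>v h = 0\<^sub>v (dimC ori (k + 1))"
    and u_eq: "u = h + (?A *\<^sub>v (?A' *\<^sub>v y) + ?B' *\<^sub>v (?B *\<^sub>v y))"
    by blast
  define p where "p = ?A *\<^sub>v (?A' *\<^sub>v y)"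
  define q where "q = ?B' *\<^sub>v (?B *\<^sub>v y)"
  have A'y: "?A' *\<^sub>v y \<in> carrier_vec (dimC ori l)" and By: "?B *\<^sub>v y \<in> carrier_vec (dimC ori (k + 1))"
    using mult_mat_vec_carrier[OF A' y] mult_mat_vec_carrier[OF B y] .
  have p: "p \<in> carrier_vec (dimC ori k)" and q: "q \<in> carrier_vec (dimC ori k)"
    unfolding p_def q_def using mult_mat_vec_carrier[OF A A'y] mult_mat_vec_carrier[OF B' By] .
  have pq: "p + q \<in> carrier_vec (dimC ori k)" using p q by simp
  have u_eq': "u = h + (p + q)" using u_eq by (simp add: p_def q_def)
  have "?B *\<^sub>v p = 0\<^sub>v (dimC ori (k + 1))"
    unfolding p_def assoc_mult_mat_vec[OF B A A'y, symmetric] using dd_dd[OF l] A'y by (auto simp: kl)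
  then have Bu: "?B *\<^sub>v u = ?B *\<^sub>v q"
    using mult_mat_vec_carrier[OF B q] Bh
    by (simp add: u_eq' mult_add_distrib_mat_vec[OF B h pq] mult_add_distrib_mat_vec[OF B p q])
  have "?A' *\<^sub>v q = 0\<^sub>v (dimC ori l)"
    unfolding q_def assoc_mult_mat_vec[OF A' B' By, symmetric] using dd_star_dd_star[OF l] By by (auto simp: kl)
  then have A'u: "?A' *\<^sub>v u = ?A' *\<^sub>v p"
    using mult_mat_vec_carrier[OF A' p] A'h
    by (simp add: u_eq' mult_add_distrib_mat_vec[OF A' h pq] mult_add_distrib_mat_vec[OF A' p q])
  have "p \<in> mat_im ?A" unfolding p_def mat_im_def using A'y A by auto
  then have p_le: "nrm B D k p \<le> cs * nrm B D (k - 1) (?A' *\<^sub>v u)"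
    using PS unfolding poincare_star_def l_def[symmetric] A'u by blast
  have "q \<in> mat_im ?B'" unfolding q_def mat_im_def using By B' by auto
  then have q_le: "nrm B D k q \<le> c * nrm B D (k + 1) (?B *\<^sub>v u)"
    using P unfolding poincare_def Bu by blast
  have "u - h = p + q" unfolding u_eq' using h p q by (intro eq_vecI) auto
  then have "nrm B D k (u - h) \<le> nrm B D k p + nrm B D k q"
    using wnrm_triangle[OF p q weight_pos] by (simp add: nrm_eq_wnrm p q pq)
  also have "\<dots> \<le> c * nrm B D (k + 1) (?B *\<^sub>v u) + cs * nrm B D (k - 1) (?A' *\<^sub>v u)"
    using p_le q_le by simp
  finally have "nrm B D k (u - h) \<le> c * nrm B D (k + 1) (?B *\<^sub>v u) + cs * nrm B D (k - 1) (?A' *\<^sub>v u)" .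
  moreover have "h \<in> mat_kernel (laplacian K ori B D k)"
  proof (rule mat_kernelI)
    show "laplacian K ori B D k \<in> carrier_mat (dimC ori k) (dimC ori k)"
      unfolding laplacian_def l_def[symmetric] using A A' B B' by simp
    show "laplacian K ori B D k *\<^sub>v h = 0\<^sub>v (dimC ori k)"
      unfolding laplacian_def l_def[symmetric] by (rule Lh)
  qed (rule h)
  ultimately show ?thesis unfolding l_def by blast
qed

text \<open>
  A Poincare constant may be zero or negative when the image that it refers to is zero; the absolute
  values and the summand \<open>1\<close> make the combined constant positive in any case.
\<close>

lemma harmonic_distance_Inf_bound:
  assumes k: "0 \<le> k" and P: "poincare K ori B D k c" and PS: "poincare_star K ori B D k cs"
    and u: "u \<in> carrier_vec (dimC ori k)"
  shows "(INF h \<in> mat_kernel (laplacian K ori B D k). nrm B D k (u - h))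
    \<le> (\<bar>c\<bar> + \<bar>cs\<bar> + 1) * (nrm B D (k + 1) (dd K ori B k *\<^sub>v u) +
        nrm B D (k - 1) (dd_star K ori D (k - 1) *\<^sub>v u))"
proof -
  let ?a = "nrm B D (k + 1) (dd K ori B k *\<^sub>v u)"
    and ?b = "nrm B D (k - 1) (dd_star K ori D (k - 1) *\<^sub>v u)"
  have L: "dim_col (laplacian K ori B D k) = dimC ori k"
    unfolding laplacian_def using dd_carrier[of k] dd_star_carrier[of k] by auto
  obtain h where h: "h \<in> mat_kernel (laplacian K ori B D k)" "nrm B D k (u - h) \<le> c * ?a + cs * ?b"
    using harmonic_distance_bound[OF assms] by blast
  have "bdd_below ((\<lambda>h. nrm B D k (u - h)) ` mat_kernel (laplacian K ori B D k))"
    using u by (intro bdd_belowI2[of _ 0] nrm_nonneg) (auto simp: mat_kernel_def L)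
  then have "(INF h \<in> mat_kernel (laplacian K ori B D k). nrm B D k (u - h)) \<le> nrm B D k (u - h)"
    using h(1) by (rule cINF_lower)
  also note h(2)
  also have "c * ?a + cs * ?b \<le> (\<bar>c\<bar> + \<bar>cs\<bar> + 1) * ?a + (\<bar>c\<bar> + \<bar>cs\<bar> + 1) * ?b"
  proof (intro add_mono mult_right_mono)
    show "0 \<le> ?a" using nrm_nonneg[OF mult_mat_vec_carrier[OF dd_carrier u]] .
    show "0 \<le> ?b"
      using u by (intro nrm_nonneg mult_mat_vec_carrier[OF dd_star_carrier]) simp
  qed auto
  finally show ?thesis by (simp add: distrib_left)
qed

end

theorem theorem3p4:
  shows "\<exists>C :: real \<Rightarrow> real \<Rightarrow> real. (\<forall>c cs. 0 < C c cs) \<and>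
    (\<forall>(d::nat) (V :: 'a set) (K :: 'a set set) (ori :: int \<Rightarrow> 'a list list)
        (B :: int \<Rightarrow> real mat) (D :: int \<Rightarrow> real mat).
      1 \<le> d \<and> clique_complex d V K \<and> (\<forall>k. is_orientation K k (ori k)) \<and>
      (\<forall>k. pos_diag (dimC ori k) (B k)) \<and> (\<forall>k. pos_diag (dimC ori k) (D k)) \<longrightarrow>
      (\<forall>k \<in> {0..int d}.
        (\<exists>c. poincare K ori B D k c) \<and>
        (\<exists>cs. poincare_star K ori B D k cs) \<and>
        (\<forall>c cs. poincare K ori B D k c \<and> poincare_star K ori B D k cs \<longrightarrow>
          (\<forall>u \<in> carrier_vec (dimC ori k).
            (INF h \<in> mat_kernel (laplacian K ori B D k). nrm B D k (u - h))
              \<le> C c cs * (nrm B D (k + 1) (dd K ori B k *\<^sub>v u) +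
                          nrm B D (k - 1) (dd_star K ori D (k - 1) *\<^sub>v u))))))"
proof (intro exI[of _ "\<lambda>c cs. \<bar>c\<bar> + \<bar>cs\<bar> + 1"] conjI allI impI ballI)
  show "0 < \<bar>c\<bar> + \<bar>cs\<bar> + 1" for c cs :: real by simp
next
  fix d and V :: "'a set" and K and ori :: "int \<Rightarrow> 'a list list" and B D and k :: int
  assume "1 \<le> d \<and> clique_complex d V K \<and> (\<forall>k. is_orientation K k (ori k)) \<and>
      (\<forall>k. pos_diag (dimC ori k) (B k)) \<and> (\<forall>k. pos_diag (dimC ori k) (D k))" and k: "k \<in> {0..int d}"
  then interpret weighted_clique_complex d V K ori B D by unfold_locales auto
  show "\<exists>c. poincare K ori B D k c" by (rule poincare_exists)
  show "\<exists>cs. poincare_star K ori B D k cs" by (rule poincare_star_exists)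
  fix c cs and u :: "real vec"
  assume "poincare K ori B D k c \<and> poincare_star K ori B D k cs" "u \<in> carrier_vec (dimC ori k)"
  then show "(INF h \<in> mat_kernel (laplacian K ori B D k). nrm B D k (u - h))
    \<le> (\<bar>c\<bar> + \<bar>cs\<bar> + 1) * (nrm B D (k + 1) (dd K ori B k *\<^sub>v u) +
        nrm B D (k - 1) (dd_star K ori D (k - 1) *\<^sub>v u))"
    using k by (intro harmonic_distance_Inf_bound) auto
qed

end
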